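(* For every positive integer $n$, $|B_n(132,213,321)|=|B_n(132,312,321)|=|B_n(213,231,321)|$.
   Context: A permutation $\sigma\in S_n$ is written as $\sigma(1)\cdots\sigma(n)$. An index $i\in[n-1]$ is an ascent if $\sigma(i)<\sigma(i+1)$ and a descent if $\sigma(i)>\sigma(i+1)$. A ballot permutation is a permutation such that every prefix $\sigma(1)\cdots\sigma(p)$ has at least as many ascents as descents. $\sigma$ contains a pattern $\pi\in S_k$ if some subsequence $\sigma(c_1)\cdots\sigma(c_k)$ with $c_1<\dots<c_k$ is order-isomorphic to $\pi$, and avoids $\pi$ otherwise. $B_n(\pi_1,\dots,\pi_m)$ denotes the set of ballot permutations of length $n$ avoiding all of $\pi_1,\dots,\pi_m$. *)

theory Defs
  imports "HOL-Library.Sublist" "HOL-Combinatorics.Multiset_Permutations"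
begin

text \<open>
  A permutation in \<open>S\<^sub>n\<close> is its one-line word \<open>[\<sigma>(1), \<dots>, \<sigma>(n)]\<close>, an element of
  \<^term>\<open>permutations_of_set {1..n}\<close>.  Since lists are indexed from 0, the index \<open>i \<in> [n - 1]\<close>
  of an ascent or descent appears below as \<open>i - 1\<close>.
\<close>

definition ascents :: "nat list \<Rightarrow> nat set" where
  "ascents \<sigma> = {i. Suc i < length \<sigma> \<and> \<sigma> ! i < \<sigma> ! Suc i}"

definition descents :: "nat list \<Rightarrow> nat set" where
  "descents \<sigma> = {i. Suc i < length \<sigma> \<and> \<sigma> ! i > \<sigma> ! Suc i}"

definition ballot :: "nat list \<Rightarrow> bool" where
  "ballot \<sigma> \<longleftrightarrow> (\<forall>\<tau>. prefix \<tau> \<sigma> \<longrightarrow> card (ascents \<tau>) \<ge> card (descents \<tau>))"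

definition order_isomorphic :: "nat list \<Rightarrow> nat list \<Rightarrow> bool" where
  "order_isomorphic xs ys \<longleftrightarrow> length xs = length ys \<and>
     (\<forall>i < length xs. \<forall>j < length xs. xs ! i < xs ! j \<longleftrightarrow> ys ! i < ys ! j)"

text \<open>\<^const>\<open>subseq\<close> selects not necessarily contiguous positions \<open>c\<^sub>1 < \<dots> < c\<^sub>k\<close>.\<close>

definition contains_pattern :: "nat list \<Rightarrow> nat list \<Rightarrow> bool" where
  "contains_pattern \<sigma> \<pi> \<longleftrightarrow> (\<exists>\<tau>. subseq \<tau> \<sigma> \<and> order_isomorphic \<tau> \<pi>)"

definition ballot_avoiders :: "nat \<Rightarrow> nat list set \<Rightarrow> nat list set" where
  "ballot_avoiders n P =
     {\<sigma> \<in> permutations_of_set {1..n}. ballot \<sigma> \<and> (\<forall>\<pi> \<in> P. \<not> contains_pattern \<sigma> \<pi>)}"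

end

theory Submission
  imports Defs
begin

text \<open>
  In each of the three classes, splitting a permutation at its smallest (or, for
  \<open>{213, 231, 321}\<close>, its largest) letter \<open>a\<close> as \<open>as @ a # bs\<close> and applying the forbidden patterns
  to triples containing \<open>a\<close> forces \<open>as @ bs\<close> (or \<open>bs @ as\<close>, for \<open>{132, 213, 321}\<close>) to be
  increasing. So there are \<open>n\<close> such permutations, each a concatenation of two increasing runs, and
  such a word is ballot unless its first step is a descent. This discards exactly one permutation
  from each class when \<open>n \<ge> 2\<close>, and none when \<open>n = 1\<close>.
\<close>

section \<open>Patterns of length three as chains of inequalities\<close>

lemma contains_pattern_length3:
  "contains_pattern w [a, b, c] \<longleftrightarrow>
     (\<exists>x y z. subseq [x, y, z] w \<and> order_isomorphic [x, y, z] [a, b, c])"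
proof
  assume "contains_pattern w [a, b, c]"
  then obtain t where t: "subseq t w" "order_isomorphic t [a, b, c]"
    unfolding contains_pattern_def by blast
  from t(2) have "length t = Suc (Suc (Suc 0))" by (simp add: order_isomorphic_def)
  then obtain x y z where "t = [x, y, z]" by (auto simp: length_Suc_conv)
  with t show "\<exists>x y z. subseq [x, y, z] w \<and> order_isomorphic [x, y, z] [a, b, c]" by blast
qed (auto simp: contains_pattern_def)

lemma order_isomorphic_length3:
  "order_isomorphic [x, y, z] [a, b, c] \<longleftrightarrow>
     (x < y \<longleftrightarrow> a < b) \<and> (y < x \<longleftrightarrow> b < a) \<and> (x < z \<longleftrightarrow> a < c) \<and>
     (z < x \<longleftrightarrow> c < a) \<and> (y < z \<longleftrightarrow> b < c) \<and> (z < y \<longleftrightarrow> c < b)"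
  by (auto simp: order_isomorphic_def All_less_Suc numeral_3_eq_3)

text \<open>Reading the positions of a pattern in order of value gives a chain of two strict
  inequalities; the remaining comparisons in \<open>order_isomorphic_length3\<close> follow by
  transitivity.\<close>

lemma contains_pattern_iff:
  "contains_pattern w [1,3,2] \<longleftrightarrow> (\<exists>x y z. subseq [x, y, z] w \<and> x < z \<and> z < y)"
  "contains_pattern w [2,1,3] \<longleftrightarrow> (\<exists>x y z. subseq [x, y, z] w \<and> y < x \<and> x < z)"
  "contains_pattern w [2,3,1] \<longleftrightarrow> (\<exists>x y z. subseq [x, y, z] w \<and> z < x \<and> x < y)"
  "contains_pattern w [3,1,2] \<longleftrightarrow> (\<exists>x y z. subseq [x, y, z] w \<and> y < z \<and> z < x)"
  "contains_pattern w [3,2,1] \<longleftrightarrow> (\<exists>x y z. subseq [x, y, z] w \<and> z < y \<and> y < x)"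
proof -
  have "order_isomorphic [x, y, z] [1,3,2] \<longleftrightarrow> x < z \<and> z < y"
    "order_isomorphic [x, y, z] [2,1,3] \<longleftrightarrow> y < x \<and> x < z"
    "order_isomorphic [x, y, z] [2,3,1] \<longleftrightarrow> z < x \<and> x < y"
    "order_isomorphic [x, y, z] [3,1,2] \<longleftrightarrow> y < z \<and> z < x"
    "order_isomorphic [x, y, z] [3,2,1] \<longleftrightarrow> z < y \<and> y < x" for x y z
    unfolding order_isomorphic_length3 by auto
  then show
    "contains_pattern w [1,3,2] \<longleftrightarrow> (\<exists>x y z. subseq [x, y, z] w \<and> x < z \<and> z < y)"
    "contains_pattern w [2,1,3] \<longleftrightarrow> (\<exists>x y z. subseq [x, y, z] w \<and> y < x \<and> x < z)"
    "contains_pattern w [2,3,1] \<longleftrightarrow> (\<exists>x y z. subseq [x, y, z] w \<and> z < x \<and> x < y)"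
    "contains_pattern w [3,1,2] \<longleftrightarrow> (\<exists>x y z. subseq [x, y, z] w \<and> y < z \<and> z < x)"
    "contains_pattern w [3,2,1] \<longleftrightarrow> (\<exists>x y z. subseq [x, y, z] w \<and> z < y \<and> y < x)"
    unfolding contains_pattern_length3 by presburger+
qed

section \<open>Increasing words and subsequences of concatenations\<close>

lemma sorted_iff_subseq:
  fixes w :: "'a::linorder list"
  shows "sorted w \<longleftrightarrow> (\<forall>x y. subseq [x, y] w \<longrightarrow> x \<le> y)"
proof (induction w)
  case (Cons a w)
  have "subseq [x, y] (a # w) \<longleftrightarrow> x = a \<and> y \<in> set w \<or> subseq [x, y] w" for x y
    by (auto simp: subseq_singleton_left dest: subseq_Cons')
  with Cons.IH show ?case by auto
qed simp

lemma subseq_set_subset: "subseq us w \<Longrightarrow> set us \<subseteq> set w"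
  by (induction rule: list_emb.induct) auto

text \<open>Every pair taken from \<open>as\<close> extends by the pivot \<open>a\<close> to a
  triple of the whole word, so a condition on triples ending in \<open>a\<close> controls all of
  \<open>as\<close>. The lemma after this one is the mirror case, with \<open>a\<close> in
  front.\<close>

lemma sorted_before_pivot:
  fixes as :: "'a::linorder list"
  assumes "\<And>x y. x \<in> set as \<Longrightarrow> y \<in> set as \<Longrightarrow> subseq [x, y, a] (as @ a # bs) \<Longrightarrow> x \<le> y"
  shows "sorted as"
  unfolding sorted_iff_subseq
proof (intro allI impI)
  fix x y assume "subseq [x, y] as"
  then show "x \<le> y"
    using assms[of x y] list_emb_append_mono[of "(=)" "[x, y]" as "[a]" "a # bs"]
      subseq_set_subset[of "[x, y]" as] by simp
qed

lemma sorted_after_pivot: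
  fixes bs :: "'a::linorder list"
  assumes "\<And>x y. x \<in> set bs \<Longrightarrow> y \<in> set bs \<Longrightarrow> subseq [a, x, y] (as @ a # bs) \<Longrightarrow> x \<le> y"
  shows "sorted bs"
  unfolding sorted_iff_subseq
proof (intro allI impI)
  fix x y assume "subseq [x, y] bs"
  then show "x \<le> y"
    using assms[of x y] list_emb_append_mono[of "(=)" "[]" as "[a, x, y]" "a # bs"]
      subseq_set_subset[of "[x, y]" bs] by simp
qed

lemma subseq_around_pivot:
  "x \<in> set as \<Longrightarrow> y \<in> set bs \<Longrightarrow> subseq [x, a, y] (as @ a # bs)"
  using list_emb_append_mono[of "(=)" "[x]" as "[a, y]" "a # bs"]
  by (simp add: subseq_singleton_left)

text \<open>The triple is cut by the seam between the runs, and each piece inherits sortedness from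
  its run. The cuts 3+0 and 0+3 give the first alternative, 2+1 the second, 1+2 the third.\<close>

lemma subseq3_two_runs:
  fixes xs ys :: "'a::linorder list"
  assumes "subseq [x, y, z] (xs @ ys)" "sorted xs" "sorted ys"
  obtains "x \<le> y" "y \<le> z"
    | "x \<le> y" "x \<in> set xs" "y \<in> set xs" "z \<in> set ys"
    | "y \<le> z" "x \<in> set xs" "y \<in> set ys" "z \<in> set ys"
proof -
  from assms(1) obtain us vs where uv: "[x, y, z] = us @ vs" "subseq us xs" "subseq vs ys"
    by (auto elim: subseq_appendE)
  have "sorted us" "sorted vs"
    using uv assms by (meson sorted_iff_subseq subseq_order.trans)+
  moreover have "set us \<subseteq> set xs" "set vs \<subseteq> set ys"
    using uv by (simp_all add: subseq_set_subset)
  ultimately show thesis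
    using uv(1) that by (auto simp: Cons_eq_append_conv)
qed

section \<open>The ballot condition\<close>

text \<open>A descent can occur only at the seam, so a prefix has at most one. A prefix with that
  descent contains all of \<open>xs\<close>, which is then nonempty and so has at least two letters;
  its first step is an ascent that pays for the descent.\<close>

lemma ballot_two_runs:
  assumes "sorted_wrt (<) xs" "sorted_wrt (<) ys" "length xs \<noteq> 1"
  shows "ballot (xs @ ys)"
  unfolding ballot_def
proof (intro allI impI)
  fix t assume "prefix t (xs @ ys)"
  then have t: "t ! i = (xs @ ys) ! i" if "i < length t" for i
    using that by (auto simp: prefix_def nth_append_left)
  from \<open>prefix t (xs @ ys)\<close> have len: "length t \<le> length xs + length ys"
    using prefix_length_le by fastforce
  have sub: "Suc i = length xs" if "i \<in> descents t" for i
  proof (rule ccontr)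
    assume "Suc i \<noteq> length xs"
    \<comment> \<open>Away from the seam both positions lie in the same run; in \<open>ys\<close>
      the indices are shifted by \<open>length xs\<close>.\<close>
    then have "(xs @ ys) ! i < (xs @ ys) ! Suc i"
      using that len sorted_wrt_nth_less[OF assms(1), of i "Suc i"]
        sorted_wrt_nth_less[OF assms(2), of "i - length xs" "Suc i - length xs"]
      by (auto simp: descents_def nth_append)
    with that t show False by (auto simp: descents_def)
  qed
  show "card (descents t) \<le> card (ascents t)"
  proof (cases "descents t = {}")
    case False
    then obtain i where i: "i \<in> descents t" by blast
    have "j = i" if "j \<in> descents t" for j
      using sub[OF that] sub[OF i] by simp
    with i have "descents t = {i}" by blast
    moreover have "0 \<in> ascents t"
    proof -
      have "0 < length xs" "0 < length t" "1 < length xs" "1 < length t"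
        using sub[OF i] i assms(3) by (auto simp: descents_def)
      moreover from this have "t ! 0 = xs ! 0" "t ! 1 = xs ! 1"
        using t by (simp_all only: nth_append_left)
      ultimately show ?thesis
        using sorted_wrt_nth_less[OF assms(1), of 0 1] by (simp add: ascents_def)
    qed
    moreover have "finite (ascents t)"
      by (rule finite_subset[of _ "{..<length t}"]) (auto simp: ascents_def)
    ultimately show ?thesis by (auto simp: Suc_le_eq card_gt_0_iff)
  qed simp
qed

text \<open>The prefix of length two already has one descent and no ascent.\<close>

lemma not_ballot_initial_descent:
  assumes "y < x"
  shows "\<not> ballot (x # y # w)"
proof
  assume "ballot (x # y # w)"
  then have "card (descents [x, y]) \<le> card (ascents [x, y])"
    unfolding ballot_def by simp
  moreover have "descents [x, y] = {0}" "ascents [x, y] = {}"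
    using assms by (auto simp: descents_def ascents_def)
  ultimately show False by simp
qed

section \<open>Membership in the classes and counting by pivot position\<close>

lemma ballot_avoidersD:
  assumes "\<sigma> \<in> ballot_avoiders n P"
  shows "distinct \<sigma>" "set \<sigma> = {1..n}" "ballot \<sigma>" "\<And>\<pi>. \<pi> \<in> P \<Longrightarrow> \<not> contains_pattern \<sigma> \<pi>"
  using assms by (auto simp: ballot_avoiders_def permutations_of_set_def)

lemma ballot_avoidersI:
  assumes "distinct \<sigma>" "set \<sigma> = {1..n}" "ballot \<sigma>" "\<And>\<pi>. \<pi> \<in> P \<Longrightarrow> \<not> contains_pattern \<sigma> \<pi>"
  shows "\<sigma> \<in> ballot_avoiders n P"
  using assms by (auto simp: ballot_avoiders_def permutations_of_set_def)

lemma length_takeWhile_pivot: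
  "a \<notin> set as \<Longrightarrow> length (takeWhile (\<lambda>x. x \<noteq> a) (as @ a # bs)) = length as"
  by (subst takeWhile_append2) auto

lemma sorted_distinct_eq_upt:
  assumes "sorted xs" "distinct xs" "set xs = {a..<b}"
  shows "xs = [a..<b]"
  using assms by (intro sorted_distinct_set_unique) auto

text \<open>The word itself reveals \<open>l p\<close>: it is the length of the part before the
  first \<open>a\<close>, as \<open>takeWhile\<close> shows. Since \<open>l\<close> is injective,
  the word determines \<open>p\<close>.\<close>

lemma card_image_pivot:
  assumes "\<And>p. p \<in> S \<Longrightarrow> a \<notin> set (f p) \<and> length (f p) = l p" "inj_on l S"
  shows "card ((\<lambda>p. f p @ a # g p) ` S) = card S"
proof (rule card_image, rule inj_onI)
  fix p q assume "p \<in> S" "q \<in> S" "f p @ a # g p = f q @ a # g q"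
  then have "l p = l q"
    using assms(1) length_takeWhile_pivot by metis
  with assms(2) \<open>p \<in> S\<close> \<open>q \<in> S\<close> show "p = q" by (auto dest: inj_onD)
qed

section \<open>Explicit descriptions of the three classes\<close>

text \<open>With 1 as pivot, 321 makes the letters before it increase, 132 those after it, and 213
  puts the former above the latter. Here \<open>q\<close> counts the letters after 1, so
  \<open>n - 1 - q\<close> precede it, and \<open>q + 2 = n\<close> is the case of exactly one, an
  initial descent. The additive form avoids truncated subtraction: for \<open>n = 1\<close> nothing
  is excluded.\<close>

lemma ballot_avoiders_132_213_321:
  assumes "n \<ge> 1"
  shows "ballot_avoiders n {[1,3,2], [2,1,3], [3,2,1]} =
    (\<lambda>q. drop q [2..<Suc n] @ 1 # take q [2..<Suc n]) ` {q. q < n \<and> q + 2 \<noteq> n}"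
proof (intro set_eqI iffI)
  fix \<sigma> assume \<sigma>: "\<sigma> \<in> ballot_avoiders n {[1,3,2], [2,1,3], [3,2,1]}"
  note D = ballot_avoidersD[OF \<sigma>]
  have "\<not> contains_pattern \<sigma> [1,3,2]" "\<not> contains_pattern \<sigma> [2,1,3]"
      "\<not> contains_pattern \<sigma> [3,2,1]"
    by (simp_all add: D(4))
  then have avoids: "\<not> (x < z \<and> z < y)" "\<not> (y < x \<and> x < z)" "\<not> (z < y \<and> y < x)"
    if "subseq [x, y, z] \<sigma>" for x y z
    using that unfolding contains_pattern_iff by blast+
  from D(2) assms have "1 \<in> set \<sigma>" by simp
  then obtain as bs where eq: "\<sigma> = as @ 1 # bs" by (auto dest: split_list)
  have gt: "x > 1" if "x \<in> set as \<union> set bs" for x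
  proof -
    have "x \<in> {1..n}" "x \<noteq> 1" using that D(1,2) eq by auto
    then show ?thesis by simp
  qed
  have sorted_as: "sorted as"
  proof (rule sorted_before_pivot)
    fix x y assume "x \<in> set as" "y \<in> set as" "subseq [x, y, 1] (as @ 1 # bs)"
    then show "x \<le> y" using avoids(3) gt[of x] gt[of y] eq by force
  qed
  have sorted_bs: "sorted bs"
  proof (rule sorted_after_pivot)
    fix x y assume "x \<in> set bs" "y \<in> set bs" "subseq [1, x, y] (as @ 1 # bs)"
    then show "x \<le> y" using avoids(1) gt[of x] gt[of y] eq by force
  qed
  have "y \<le> x" if "x \<in> set as" "y \<in> set bs" for x y
    using avoids(2)[of x 1 y] subseq_around_pivot[OF that, of 1] gt[of x] gt[of y] that eq by auto
  with sorted_as sorted_bs have "sorted (bs @ as)" by (auto simp: sorted_append)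
  moreover have "set (bs @ as) = {2..<Suc n}"
  proof -
    have "set (bs @ as) = set \<sigma> - {1}" using D(1) unfolding eq by auto
    also have "\<dots> = {2..<Suc n}" unfolding D(2) by auto
    finally show ?thesis .
  qed
  ultimately have U: "bs @ as = [2..<Suc n]"
    using D(1) eq by (intro sorted_distinct_eq_upt) auto
  then have len: "length bs + length as = n - 1"
    by (metis length_append length_upt diff_Suc_Suc One_nat_def numeral_2_eq_2)
  have "length as \<noteq> 1"
  proof
    assume "length as = 1"
    then obtain x where "as = [x]" by (auto simp: length_Suc_conv)
    with not_ballot_initial_descent[of 1 x bs] D(3) gt eq show False by auto
  qed
  with len assms have "length bs \<in> {q. q < n \<and> q + 2 \<noteq> n}" by auto
  moreover have "\<sigma> = drop (length bs) [2..<Suc n] @ 1 # take (length bs) [2..<Suc n]"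
    unfolding U[symmetric] using eq by simp
  ultimately show "\<sigma> \<in> (\<lambda>q. drop q [2..<Suc n] @ 1 # take q [2..<Suc n]) ` {q. q < n \<and> q + 2 \<noteq> n}"
    by blast
next
  fix \<sigma> assume "\<sigma> \<in> (\<lambda>q. drop q [2..<Suc n] @ 1 # take q [2..<Suc n]) ` {q. q < n \<and> q + 2 \<noteq> n}"
  then obtain q where q: "q < n" "q + 2 \<noteq> n"
    and eq: "\<sigma> = drop q [2..<Suc n] @ 1 # take q [2..<Suc n]" by blast
  define as bs where "as = drop q [2..<Suc n]" and "bs = take q [2..<Suc n]"
  have as: "as = [2 + q..<Suc n]" and bs: "bs = [2..<2 + q]"
    using q by (simp_all add: as_def bs_def drop_upt take_upt del: upt_Suc)
  \<comment> \<open>The pivot 1 is smallest, so it heads the second run.\<close>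
  have srt: "sorted_wrt (<) as" "sorted_wrt (<) (1 # bs)"
    by (auto simp: as bs simp del: upt_Suc)
  then have srt': "sorted as" "sorted (1 # bs)" by (auto simp: strict_sorted_iff)
  show "\<sigma> \<in> ballot_avoiders n {[1,3,2], [2,1,3], [3,2,1]}"
    unfolding eq as_def[symmetric] bs_def[symmetric]
  proof (rule ballot_avoidersI)
    show "distinct (as @ 1 # bs)" by (auto simp: as bs)
    show "set (as @ 1 # bs) = {1..n}" using q by (auto simp: as bs)
    show "ballot (as @ 1 # bs)" using srt by (rule ballot_two_runs) (use q in \<open>auto simp: as\<close>)
    \<comment> \<open>The first run lies entirely above the second, so a triple crossing the seam
      has pattern 231 or 312.\<close>
    have "\<not> (x < z \<and> z < y) \<and> \<not> (y < x \<and> x < z) \<and> \<not> (z < y \<and> y < x)"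
      if "subseq [x, y, z] (as @ 1 # bs)" for x y z
      using that srt' by (rule subseq3_two_runs) (auto simp: as bs)
    then show "\<not> contains_pattern (as @ 1 # bs) \<pi>" if "\<pi> \<in> {[1,3,2], [2,1,3], [3,2,1]}" for \<pi>
      using that by (elim insertE emptyE; simp only: contains_pattern_iff; blast)
  qed
qed

text \<open>Again 321 and 132 make the two sides of the pivot 1 increase, but 312 now puts the
  letters before 1 below those after it. Here \<open>p\<close> counts the letters before 1, and
  \<open>p = 1\<close> is the initial descent.\<close>

lemma ballot_avoiders_132_312_321:
  assumes "n \<ge> 1"
  shows "ballot_avoiders n {[1,3,2], [3,1,2], [3,2,1]} =
    (\<lambda>p. take p [2..<Suc n] @ 1 # drop p [2..<Suc n]) ` ({..<n} - {1})"
proof (intro set_eqI iffI)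
  fix \<sigma> assume \<sigma>: "\<sigma> \<in> ballot_avoiders n {[1,3,2], [3,1,2], [3,2,1]}"
  note D = ballot_avoidersD[OF \<sigma>]
  have "\<not> contains_pattern \<sigma> [1,3,2]" "\<not> contains_pattern \<sigma> [3,1,2]"
      "\<not> contains_pattern \<sigma> [3,2,1]"
    by (simp_all add: D(4))
  then have avoids: "\<not> (x < z \<and> z < y)" "\<not> (y < z \<and> z < x)" "\<not> (z < y \<and> y < x)"
    if "subseq [x, y, z] \<sigma>" for x y z
    using that unfolding contains_pattern_iff by blast+
  from D(2) assms have "1 \<in> set \<sigma>" by simp
  then obtain as bs where eq: "\<sigma> = as @ 1 # bs" by (auto dest: split_list)
  have gt: "x > 1" if "x \<in> set as \<union> set bs" for x
  proof -
    have "x \<in> {1..n}" "x \<noteq> 1" using that D(1,2) eq by auto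
    then show ?thesis by simp
  qed
  have sorted_as: "sorted as"
  proof (rule sorted_before_pivot)
    fix x y assume "x \<in> set as" "y \<in> set as" "subseq [x, y, 1] (as @ 1 # bs)"
    then show "x \<le> y" using avoids(3) gt[of x] gt[of y] eq by force
  qed
  have sorted_bs: "sorted bs"
  proof (rule sorted_after_pivot)
    fix x y assume "x \<in> set bs" "y \<in> set bs" "subseq [1, x, y] (as @ 1 # bs)"
    then show "x \<le> y" using avoids(1) gt[of x] gt[of y] eq by force
  qed
  have "x \<le> y" if "x \<in> set as" "y \<in> set bs" for x y
    using avoids(2)[of x 1 y] subseq_around_pivot[OF that, of 1] gt[of x] gt[of y] that eq by auto
  with sorted_as sorted_bs have "sorted (as @ bs)" by (auto simp: sorted_append)
  moreover have "set (as @ bs) = {2..<Suc n}"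
  proof -
    have "set (as @ bs) = set \<sigma> - {1}" using D(1) unfolding eq by auto
    also have "\<dots> = {2..<Suc n}" unfolding D(2) by auto
    finally show ?thesis .
  qed
  ultimately have U: "as @ bs = [2..<Suc n]"
    using D(1) eq by (intro sorted_distinct_eq_upt) auto
  then have len: "length as + length bs = n - 1"
    by (metis length_append length_upt diff_Suc_Suc One_nat_def numeral_2_eq_2)
  have "length as \<noteq> 1"
  proof
    assume "length as = 1"
    then obtain x where "as = [x]" by (auto simp: length_Suc_conv)
    with not_ballot_initial_descent[of 1 x bs] D(3) gt eq show False by auto
  qed
  with len assms have "length as \<in> {..<n} - {1}" by auto
  moreover have "\<sigma> = take (length as) [2..<Suc n] @ 1 # drop (length as) [2..<Suc n]"
    unfolding U[symmetric] using eq by simp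
  ultimately show "\<sigma> \<in> (\<lambda>p. take p [2..<Suc n] @ 1 # drop p [2..<Suc n]) ` ({..<n} - {1})"
    by blast
next
  fix \<sigma> assume "\<sigma> \<in> (\<lambda>p. take p [2..<Suc n] @ 1 # drop p [2..<Suc n]) ` ({..<n} - {1})"
  then obtain p where p: "p < n" "p \<noteq> 1"
    and eq: "\<sigma> = take p [2..<Suc n] @ 1 # drop p [2..<Suc n]" by blast
  define as bs where "as = take p [2..<Suc n]" and "bs = drop p [2..<Suc n]"
  have as: "as = [2..<2 + p]" and bs: "bs = [2 + p..<Suc n]"
    using p by (simp_all add: as_def bs_def drop_upt take_upt del: upt_Suc)
  have srt: "sorted_wrt (<) as" "sorted_wrt (<) (1 # bs)"
    by (auto simp: as bs simp del: upt_Suc)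
  then have srt': "sorted as" "sorted (1 # bs)" by (auto simp: strict_sorted_iff)
  show "\<sigma> \<in> ballot_avoiders n {[1,3,2], [3,1,2], [3,2,1]}"
    unfolding eq as_def[symmetric] bs_def[symmetric]
  proof (rule ballot_avoidersI)
    show "distinct (as @ 1 # bs)" by (auto simp: as bs)
    show "set (as @ 1 # bs) = {1..n}" using p by (auto simp: as bs)
    show "ballot (as @ 1 # bs)" using srt by (rule ballot_two_runs) (use p in \<open>auto simp: as\<close>)
    \<comment> \<open>The letters of \<open>as\<close> lie between 1 and those of \<open>bs\<close>,
      so a triple crossing the seam has pattern 123, 213 or 231.\<close>
    have "\<not> (x < z \<and> z < y) \<and> \<not> (y < z \<and> z < x) \<and> \<not> (z < y \<and> y < x)"
      if "subseq [x, y, z] (as @ 1 # bs)" for x y z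
      using that srt' by (rule subseq3_two_runs) (auto simp: as bs)
    then show "\<not> contains_pattern (as @ 1 # bs) \<pi>" if "\<pi> \<in> {[1,3,2], [3,1,2], [3,2,1]}" for \<pi>
      using that by (elim insertE emptyE; simp only: contains_pattern_iff; blast)
  qed
qed

text \<open>The pivot is \<open>n\<close> because here it is the letter 3 that stands once in each
  position of the three patterns, as the letter 1 did in the other classes. So 213 makes the letters
  before \<open>n\<close> increase, 321 those after it, and 231 puts the former below the latter.
  With \<open>p\<close> letters before \<open>n\<close>, an initial descent means
  \<open>p = 0\<close> and \<open>n > 1\<close>.\<close>

lemma ballot_avoiders_213_231_321:
  assumes "n \<ge> 1"
  shows "ballot_avoiders n {[2,1,3], [2,3,1], [3,2,1]} =
    (\<lambda>p. take p [1..<n] @ n # drop p [1..<n]) ` {p. p < n \<and> (p = 0 \<longrightarrow> n = 1)}"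
proof (intro set_eqI iffI)
  fix \<sigma> assume \<sigma>: "\<sigma> \<in> ballot_avoiders n {[2,1,3], [2,3,1], [3,2,1]}"
  note D = ballot_avoidersD[OF \<sigma>]
  have "\<not> contains_pattern \<sigma> [2,1,3]" "\<not> contains_pattern \<sigma> [2,3,1]"
      "\<not> contains_pattern \<sigma> [3,2,1]"
    by (simp_all add: D(4))
  then have avoids: "\<not> (y < x \<and> x < z)" "\<not> (z < x \<and> x < y)" "\<not> (z < y \<and> y < x)"
    if "subseq [x, y, z] \<sigma>" for x y z
    using that unfolding contains_pattern_iff by blast+
  from D(2) assms have "n \<in> set \<sigma>" by simp
  then obtain as bs where eq: "\<sigma> = as @ n # bs" by (auto dest: split_list)
  have lt: "x < n" if "x \<in> set as \<union> set bs" for x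
  proof -
    have "x \<in> {1..n}" "x \<noteq> n" using that D(1,2) eq by auto
    then show ?thesis by simp
  qed
  have sorted_as: "sorted as"
  proof (rule sorted_before_pivot)
    fix x y assume "x \<in> set as" "y \<in> set as" "subseq [x, y, n] (as @ n # bs)"
    then show "x \<le> y" using avoids(1) lt[of x] lt[of y] eq by force
  qed
  have sorted_bs: "sorted bs"
  proof (rule sorted_after_pivot)
    fix x y assume "x \<in> set bs" "y \<in> set bs" "subseq [n, x, y] (as @ n # bs)"
    then show "x \<le> y" using avoids(3) lt[of x] lt[of y] eq by force
  qed
  have "x \<le> y" if "x \<in> set as" "y \<in> set bs" for x y
    using avoids(2)[of x n y] subseq_around_pivot[OF that, of n] lt[of x] lt[of y] that eq by auto
  with sorted_as sorted_bs have "sorted (as @ bs)" by (auto simp: sorted_append)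
  moreover have "set (as @ bs) = {1..<n}"
  proof -
    have "set (as @ bs) = set \<sigma> - {n}" using D(1) unfolding eq by auto
    also have "\<dots> = {1..<n}" unfolding D(2) by auto
    finally show ?thesis .
  qed
  ultimately have U: "as @ bs = [1..<n]"
    using D(1) eq by (intro sorted_distinct_eq_upt) auto
  then have len: "length as + length bs = n - 1"
    by (metis length_append length_upt)
  \<comment> \<open>If \<open>n\<close> comes first, any letter after it would make the first step a
    descent.\<close>
  have "n = 1" if "as = []"
  proof (cases bs)
    case (Cons y ys)
    with that not_ballot_initial_descent[of y n ys] D(3) lt eq show ?thesis by auto
  qed (use that len assms in simp)
  with len assms have "length as \<in> {p. p < n \<and> (p = 0 \<longrightarrow> n = 1)}" by auto
  moreover have "\<sigma> = take (length as) [1..<n] @ n # drop (length as) [1..<n]"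
    unfolding U[symmetric] using eq by simp
  ultimately show "\<sigma> \<in> (\<lambda>p. take p [1..<n] @ n # drop p [1..<n]) ` {p. p < n \<and> (p = 0 \<longrightarrow> n = 1)}"
    by blast
next
  fix \<sigma> assume "\<sigma> \<in> (\<lambda>p. take p [1..<n] @ n # drop p [1..<n]) ` {p. p < n \<and> (p = 0 \<longrightarrow> n = 1)}"
  then obtain p where p: "p < n" "p = 0 \<longrightarrow> n = 1"
    and eq: "\<sigma> = take p [1..<n] @ n # drop p [1..<n]" by blast
  define as bs where "as = take p [1..<n]" and "bs = drop p [1..<n]"
  have as: "as = [1..<1 + p]" and bs: "bs = [1 + p..<n]"
    using p by (simp_all add: as_def bs_def drop_upt take_upt del: upt_Suc)
  have srt: "sorted_wrt (<) (as @ [n])" "sorted_wrt (<) bs"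
    using p by (auto simp: as bs sorted_wrt_append)
  then have srt': "sorted (as @ [n])" "sorted bs" by (auto simp: strict_sorted_iff)
  \<comment> \<open>The pivot is now the largest letter, so it closes the first run, which has
    length \<open>p + 1\<close>.\<close>
  have shift: "as @ n # bs = (as @ [n]) @ bs" by simp
  show "\<sigma> \<in> ballot_avoiders n {[2,1,3], [2,3,1], [3,2,1]}"
    unfolding eq as_def[symmetric] bs_def[symmetric]
  proof (rule ballot_avoidersI)
    show "distinct (as @ n # bs)" using p by (auto simp: as bs)
    show "set (as @ n # bs) = {1..n}" using p by (auto simp: as bs)
    show "ballot (as @ n # bs)"
    \<comment> \<open>For \<open>p = 0\<close> the first run would have the forbidden length 1; the
      word is then \<open>[n]\<close>, read as an empty run followed by \<open>[n]\<close>.\<close>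
    proof (cases "p = 0")
      case True
      with p have "as @ n # bs = [] @ [n]" by (simp add: as bs)
      then show ?thesis using ballot_two_runs[of "[]" "[n]"] by simp
    next
      case False
      then show ?thesis
        unfolding shift using srt by (intro ballot_two_runs) (auto simp: as)
    qed
    \<comment> \<open>The letters of \<open>bs\<close> lie between those of \<open>as\<close> and
      \<open>n\<close>, so a triple crossing the seam has pattern 123, 132 or 312.\<close>
    have "\<not> (y < x \<and> x < z) \<and> \<not> (z < x \<and> x < y) \<and> \<not> (z < y \<and> y < x)"
      if "subseq [x, y, z] (as @ n # bs)" for x y z
      using that[unfolded shift] srt' by (rule subseq3_two_runs) (auto simp: as bs)
    then show "\<not> contains_pattern (as @ n # bs) \<pi>" if "\<pi> \<in> {[2,1,3], [2,3,1], [3,2,1]}" for \<pi>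
      using that by (elim insertE emptyE; simp only: contains_pattern_iff; blast)
  qed
qed

section \<open>Comparison of the index sets\<close>

theorem theorem4p5:
  fixes n :: nat
  assumes "n \<ge> 1"
  shows "card (ballot_avoiders n {[1,3,2], [2,1,3], [3,2,1]})
           = card (ballot_avoiders n {[1,3,2], [3,1,2], [3,2,1]})
       \<and> card (ballot_avoiders n {[1,3,2], [3,1,2], [3,2,1]})
           = card (ballot_avoiders n {[2,1,3], [2,3,1], [3,2,1]})"
proof -
  \<comment> \<open>Dropping \<open>q\<close> of the \<open>n - 1\<close> letters other than 1
    leaves \<open>n - 1 - q\<close> before the pivot, which is injective in \<open>q\<close> for
    \<open>q < n\<close>. In the other two classes the front part has length \<open>p\<close>
    itself.\<close>
  have 1: "card (ballot_avoiders n {[1,3,2], [2,1,3], [3,2,1]}) = card {q. q < n \<and> q + 2 \<noteq> n}"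
    unfolding ballot_avoiders_132_213_321[OF assms]
    by (rule card_image_pivot[where l = "\<lambda>q. n - 1 - q"])
       (auto dest: in_set_dropD intro!: inj_onI)
  have 2: "card (ballot_avoiders n {[1,3,2], [3,1,2], [3,2,1]}) = card ({..<n} - {1})"
    unfolding ballot_avoiders_132_312_321[OF assms]
    by (rule card_image_pivot[where l = id]) (auto dest: in_set_takeD)
  have 3: "card (ballot_avoiders n {[2,1,3], [2,3,1], [3,2,1]})
      = card {p. p < n \<and> (p = 0 \<longrightarrow> n = 1)}"
    unfolding ballot_avoiders_213_231_321[OF assms]
    by (rule card_image_pivot[where l = id]) (auto dest: in_set_takeD)
  show ?thesis
  proof (cases "n = 1")
    case True
    then have "{q. q < n \<and> q + 2 \<noteq> n} = {0}" "{..<n} - {1} = {0}"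
      "{p. p < n \<and> (p = 0 \<longrightarrow> n = 1)} = {0}" by auto
    with 1 2 3 show ?thesis by simp
  next
    case False
    \<comment> \<open>For \<open>n \<ge> 2\<close> each index set is \<open>{..<n}\<close> with one
      of its elements removed (\<open>n - 2\<close>, 1 and 0 respectively), so all three have
      \<open>n - 1\<close> elements.\<close>
    with assms have "{q. q < n \<and> q + 2 \<noteq> n} = {..<n} - {n - 2}"
      "{p. p < n \<and> (p = 0 \<longrightarrow> n = 1)} = {..<n} - {0}" by auto
    with 1 2 3 False assms show ?thesis by simp
  qed
qed

end
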